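(* If $\kappa$ is a regular cardinal, then $$\operatorname{sm}(D(2)^\kappa)=\operatorname{ps}(D(2)^\kappa)=\operatorname{ps}(\langle D(2)^\kappa,\tau_{<\kappa}\rangle)=\operatorname{sm}(\langle D(2)^\kappa,\tau_{<\kappa}\rangle)=\kappa,$$ where $D(2)^\kappa$ carries the product topology and $\tau_{<\kappa}$ denotes the topology on $D(2)^\kappa$ generated by the $G_{<\kappa}$-sets of the product topology.
   Context: Regular cardinals are infinite. $D(2)$ is the discrete two-point space. A $G_{<\kappa}$-set is an intersection of fewer than $\kappa$ open sets. Games ($X$ a topological space, $Y\subseteq X$, $\beta$ an ordinal): two players, Seeker and Hider, make $\beta$ moves. At move $\alpha<\beta$, knowing all previous moves, the Seeker chooses an open set $U_\alpha\subseteq X$, and then the Hider chooses $V_\alpha\in\{U_\alpha, X\setminus U_\alpha\}$. The outcome is $W=\bigcap_{\alpha<\beta}V_\alpha$ (with $W=X$ if $\beta=0$). In the point separating game $G_\beta(X)$ the Seeker wins iff $|W|\le 1$. In the set membership game $G_\beta(Y,X)$ the Seeker wins iff $W\subseteq Y$ or $W\cap Y=\emptyset$. For a $T_0$ space $X$: $\operatorname{ps}(X)$ is the least ordinal $\beta$ such that the Seeker has a winning strategy in $G_\beta(X)$; $\operatorname{sm}(Y,X)$ is the least ordinal $\beta$ such that the Seeker has a winning strategy in $G_\beta(Y,X)$; $\operatorname{sm}(X)=\sup\{\operatorname{sm}(Y,X):Y\subseteq X\}$. *)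

theory Defs
  imports "HOL-Analysis.Analysis"
begin

unbundle cardinal_syntax

text \<open>
  Ordinals are elements of an arbitrary type \<open>'o\<close> of class \<^class>\<open>wellorder\<close>: an element
  \<open>\<beta>\<close> stands for the order type of \<open>{..<\<beta>}\<close>, and every ordinal below an ordinal of \<open>'o\<close>
  is again represented in \<open>'o\<close>.
\<close>

definition ordinal_rel :: "'o::wellorder \<Rightarrow> 'o rel" where
  "ordinal_rel \<beta> = {(\<xi>, \<eta>). \<xi> \<le> \<eta> \<and> \<eta> < \<beta>}"

text \<open>
  The second conjunct says that \<open>\<kappa>\<close> is an initial ordinal, that is, a cardinal.
\<close>

definition regular_cardinal :: "'o::wellorder \<Rightarrow> bool" where
  "regular_cardinal \<kappa> \<longleftrightarrow>
     cinfinite (ordinal_rel \<kappa>) \<and> Card_order (ordinal_rel \<kappa>) \<and> regularCard (ordinal_rel \<kappa>)"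

definition D2_power :: "'o::wellorder \<Rightarrow> ('o \<Rightarrow> bool) topology" where
  "D2_power \<kappa> = product_topology (\<lambda>_. discrete_topology (UNIV :: bool set)) {..<\<kappa>}"

text \<open>
  The intersection of the empty family is the whole space.
\<close>

definition G_less_set :: "'o::wellorder \<Rightarrow> 'a topology \<Rightarrow> 'a set \<Rightarrow> bool" where
  "G_less_set \<kappa> X S \<longleftrightarrow>
     (\<exists>\<U>. (\<forall>U\<in>\<U>. openin X U) \<and> |\<U>| <o |{..<\<kappa>}| \<and> S = topspace X \<inter> \<Inter>\<U>)"

definition G_less_topology :: "'o::wellorder \<Rightarrow> 'a topology \<Rightarrow> 'a topology" where
  "G_less_topology \<kappa> X = topology_generated_by {S. G_less_set \<kappa> X S}"

text \<open>
  A strategy \<open>\<sigma>\<close> of the Seeker maps a stage \<open>\<alpha>\<close> and the history before it, that is, the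
  sequence of pairs of moves of the Seeker and the Hider at the stages \<open>\<xi> < \<alpha>\<close>, to the next
  move of the Seeker. The use of \<^const>\<open>restrict\<close> hides all later moves from it.
\<close>

definition seeker_strategy ::
    "'a topology \<Rightarrow> 'o::wellorder \<Rightarrow> ('o \<Rightarrow> ('o \<Rightarrow> 'a set \<times> 'a set) \<Rightarrow> 'a set) \<Rightarrow> bool" where
  "seeker_strategy X \<beta> \<sigma> \<longleftrightarrow> (\<forall>\<alpha><\<beta>. \<forall>h. openin X (\<sigma> \<alpha> h))"

definition play_by ::
    "'a topology \<Rightarrow> 'o::wellorder \<Rightarrow> ('o \<Rightarrow> ('o \<Rightarrow> 'a set \<times> 'a set) \<Rightarrow> 'a set)
       \<Rightarrow> ('o \<Rightarrow> 'a set) \<Rightarrow> ('o \<Rightarrow> 'a set) \<Rightarrow> bool" where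
  "play_by X \<beta> \<sigma> U V \<longleftrightarrow>
     (\<forall>\<alpha><\<beta>. U \<alpha> = \<sigma> \<alpha> (restrict (\<lambda>\<xi>. (U \<xi>, V \<xi>)) {..<\<alpha>}) \<and>
             V \<alpha> \<in> {U \<alpha>, topspace X - U \<alpha>})"

definition outcome :: "'a topology \<Rightarrow> 'o::wellorder \<Rightarrow> ('o \<Rightarrow> 'a set) \<Rightarrow> 'a set" where
  "outcome X \<beta> V = topspace X \<inter> (\<Inter>\<alpha>\<in>{..<\<beta>}. V \<alpha>)"

definition seeker_wins :: "('a set \<Rightarrow> bool) \<Rightarrow> 'a topology \<Rightarrow> 'o::wellorder \<Rightarrow> bool" where
  "seeker_wins goal X \<beta> \<longleftrightarrow>
     (\<exists>\<sigma>. seeker_strategy X \<beta> \<sigma> \<and> (\<forall>U V. play_by X \<beta> \<sigma> U V \<longrightarrow> goal (outcome X \<beta> V)))"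

definition seeker_wins_ps :: "'a topology \<Rightarrow> 'o::wellorder \<Rightarrow> bool" where
  "seeker_wins_ps X \<beta> \<longleftrightarrow> seeker_wins (\<lambda>W. finite W \<and> card W \<le> 1) X \<beta>"

definition seeker_wins_sm :: "'a set \<Rightarrow> 'a topology \<Rightarrow> 'o::wellorder \<Rightarrow> bool" where
  "seeker_wins_sm Y X \<beta> \<longleftrightarrow> seeker_wins (\<lambda>W. W \<subseteq> Y \<or> W \<inter> Y = {}) X \<beta>"

text \<open>
  These are the intended ordinals for a T0 space as soon as \<open>'o\<close> contains them; otherwise
  \<open>LEAST\<close> is unspecified. The supremum is the least upper bound, as \<open>'o\<close> need not be
  a complete lattice.
\<close>

definition ps :: "'a topology \<Rightarrow> 'o::wellorder" where
  "ps X = (LEAST \<beta>. seeker_wins_ps X \<beta>)"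

definition sm_at :: "'a set \<Rightarrow> 'a topology \<Rightarrow> 'o::wellorder" where
  "sm_at Y X = (LEAST \<beta>. seeker_wins_sm Y X \<beta>)"

definition sm :: "'a topology \<Rightarrow> 'o::wellorder" where
  "sm X = (LEAST \<beta>. \<forall>Y. Y \<subseteq> topspace X \<longrightarrow> sm_at Y X \<le> \<beta>)"

end

theory Submission
  imports Defs
begin

text \<open>
  Upper bounds: asking for one coordinate after the other, the Seeker pins down a single point in
  \<open>\<kappa>\<close> moves. Lower bounds: in both topologies every neighbourhood of a point \<open>x\<close> contains all points
  that agree with \<open>x\<close> below some \<open>\<gamma> < \<kappa>\<close>, by regularity. In fewer than \<open>\<kappa>\<close> moves the
  Hider can thus keep a cylinder inside all his moves so far: he accepts \<open>U\<close> if \<open>U\<close> meets this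
  cylinder, and then passes to a smaller one inside \<open>U\<close>; otherwise he rejects \<open>U\<close>. By
  regularity again the outcome contains a cylinder, which has at least two points and meets both
  the set of eventually true sequences and its complement.
\<close>

text \<open>Only the values of the centre \<open>x\<close> below \<open>\<gamma>\<close> count. For
  infinite \<open>\<gamma>\<close> below \<open>\<kappa>\<close> a cylinder is not open in the
  product topology; the argument only places cylinders inside the Hider's moves.\<close>

definition cylinder :: "'o::wellorder \<Rightarrow> ('o \<Rightarrow> bool) \<Rightarrow> 'o \<Rightarrow> ('o \<Rightarrow> bool) set" where
  "cylinder \<kappa> x \<gamma> = {y \<in> topspace (D2_power \<kappa>). \<forall>\<xi><\<gamma>. y \<xi> = x \<xi>}"

lemma topspace_D2_power: "topspace (D2_power \<kappa>) = {..<\<kappa>} \<rightarrow>\<^sub>E UNIV"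
  by (simp add: D2_power_def)

lemma cylinder_antimono: "\<gamma> \<le> \<delta> \<Longrightarrow> cylinder \<kappa> x \<delta> \<subseteq> cylinder \<kappa> x \<gamma>"
  by (auto simp: cylinder_def)

lemma cylinder_cong: "(\<And>\<xi>. \<xi> < \<gamma> \<Longrightarrow> x \<xi> = y \<xi>) \<Longrightarrow> cylinder \<kappa> x \<gamma> = cylinder \<kappa> y \<gamma>"
  by (simp add: cylinder_def)

section \<open>Regular cardinals as elements of a well-order\<close>

lemma Field_ordinal_rel: "Field (ordinal_rel \<kappa>) = {..<\<kappa>}"
  by (auto simp: ordinal_rel_def Field_def)

lemma regular_cardinal_infinite: "regular_cardinal \<kappa> \<Longrightarrow> infinite {..<\<kappa>}"
  by (auto simp: regular_cardinal_def cinfinite_def Field_ordinal_rel)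

lemma regular_cardinal_iso:
  assumes "regular_cardinal \<kappa>"
  shows "|{..<\<kappa>}| =o ordinal_rel \<kappa>"
  using assms card_of_Field_ordIso[of "ordinal_rel \<kappa>"]
  by (simp add: regular_cardinal_def Field_ordinal_rel)

text \<open>A cardinal is an initial ordinal. This makes the stages before any \<alpha> < \<kappa>
  an index set small enough for regularity.\<close>

lemma regular_cardinal_initial:
  assumes "regular_cardinal \<kappa>" and "\<alpha> < \<kappa>"
  shows "|{..<\<alpha>}| <o |{..<\<kappa>}|"
proof -
  have "underS (ordinal_rel \<kappa>) \<alpha> = {..<\<alpha>}"
    using assms(2) by (auto simp: underS_def ordinal_rel_def)
  then have "|{..<\<alpha>}| <o ordinal_rel \<kappa>"
    using assms card_of_underS[of "ordinal_rel \<kappa>" \<alpha>]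
    by (simp add: regular_cardinal_def Field_ordinal_rel)
  then show ?thesis
    using regular_cardinal_iso[OF assms(1)] ordIso_symmetric ordLess_ordIso_trans by blast
qed

lemma regular_cardinal_limit:
  assumes "regular_cardinal \<kappa>" and "\<alpha> < \<kappa>"
  obtains \<beta> where "\<alpha> < \<beta>" and "\<beta> < \<kappa>"
proof -
  have "\<exists>\<beta>\<in>{..<\<kappa>}. \<alpha> \<noteq> \<beta> \<and> (\<alpha>, \<beta>) \<in> ordinal_rel \<kappa>"
    using assms infinite_Card_order_limit[of "ordinal_rel \<kappa>" \<alpha>]
    by (simp add: regular_cardinal_def cinfinite_def Field_ordinal_rel)
  then show thesis
    using that by (auto simp: ordinal_rel_def intro: le_neq_trans)
qed

lemma regular_cardinal_finite:
  assumes "regular_cardinal \<kappa>" and "finite A"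
  shows "|A| <o |{..<\<kappa>}|"
  using assms(2) regular_cardinal_infinite[OF assms(1)]
  by (intro finite_ordLess_infinite card_of_Well_order) (simp_all add: Field_card_of)

text \<open>Regularity in the form used below: the image of a small index set is again small, hence
  not cofinal in \<kappa>.\<close>

lemma regular_cardinal_bound:
  assumes "regular_cardinal \<kappa>" and "|A| <o |{..<\<kappa>}|" and "\<And>a. a \<in> A \<Longrightarrow> g a < \<kappa>"
  obtains \<gamma> where "\<gamma> < \<kappa>" and "\<And>a. a \<in> A \<Longrightarrow> g a < \<gamma>"
proof -
  have "|g ` A| <o ordinal_rel \<kappa>"
    using assms(2) regular_cardinal_iso[OF assms(1)] card_of_image[of g A]
      ordLeq_ordLess_trans ordLess_ordIso_trans by blast
  then have "\<not> cofinal (g ` A) (ordinal_rel \<kappa>)"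
    using assms(1,3) not_ordLess_ordIso
    unfolding regular_cardinal_def regularCard_def Field_ordinal_rel by blast
  \<comment> \<open>The relation \<open>cofinal\<close> asks for strictly larger elements, so its
    failure yields only a weak bound; the limit property of \<kappa> then makes it strict.\<close>
  then obtain \<delta> where \<delta>: "\<delta> < \<kappa>" "\<And>a. a \<in> A \<Longrightarrow> g a \<le> \<delta>"
    using assms(3) unfolding cofinal_def Field_ordinal_rel
    by (force simp: ordinal_rel_def not_le less_le)
  obtain \<gamma> where "\<delta> < \<gamma>" "\<gamma> < \<kappa>"
    using regular_cardinal_limit[OF assms(1) \<delta>(1)] .
  then show thesis
    using that \<delta>(2) by (meson le_less_trans)
qed

section \<open>Cylinders inside open sets of the two topologies\<close>

text \<open>A basic box around \<open>x\<close> restricts finitely many coordinates, and all of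
  these lie below some \<gamma> < \<kappa>.\<close>

lemma D2_power_open_cylinder:
  assumes "regular_cardinal \<kappa>" and "openin (D2_power \<kappa>) U" and "x \<in> U"
  obtains \<gamma> where "\<gamma> < \<kappa>" and "cylinder \<kappa> x \<gamma> \<subseteq> U"
proof -
  obtain B where B: "finite {i \<in> {..<\<kappa>}. B i \<noteq> UNIV}" "x \<in> Pi\<^sub>E {..<\<kappa>} B" "Pi\<^sub>E {..<\<kappa>} B \<subseteq> U"
    using assms(2,3) by (auto simp: D2_power_def openin_product_topology_alt)
  obtain \<gamma> where \<gamma>: "\<gamma> < \<kappa>" "\<And>i. i \<in> {i \<in> {..<\<kappa>}. B i \<noteq> UNIV} \<Longrightarrow> i < \<gamma>"
    using regular_cardinal_bound[OF assms(1), of "{i \<in> {..<\<kappa>}. B i \<noteq> UNIV}" "\<lambda>i. i"]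
      regular_cardinal_finite[OF assms(1) B(1)] by blast
  have "y \<in> Pi\<^sub>E {..<\<kappa>} B" if y: "y \<in> cylinder \<kappa> x \<gamma>" for y
  proof (rule PiE_I)
    fix i assume "i \<in> {..<\<kappa>}"
    then show "y i \<in> B i"
      using y \<gamma>(2)[of i] B(2) by (cases "B i = UNIV") (auto simp: cylinder_def PiE_iff)
  next
    fix i assume "i \<notin> {..<\<kappa>}"
    then show "y i = undefined"
      using y by (auto simp: cylinder_def topspace_D2_power)
  qed
  then show thesis
    using that \<gamma>(1) B(3) by blast
qed

text \<open>A one-element family is small because \<kappa> is infinite; hence the generated topology
  refines the original one.\<close>

lemma G_less_set_open:
  assumes "regular_cardinal \<kappa>" and "openin X U"
  shows "G_less_set \<kappa> X U"
proof -
  have "|{U}| <o |{..<\<kappa>}|"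
    using regular_cardinal_finite[OF assms(1)] by blast
  then show ?thesis
    using assms(2) openin_subset[OF assms(2)] unfolding G_less_set_def
    by (intro exI[of _ "{U}"]) auto
qed

lemma topspace_G_less_topology:
  assumes "regular_cardinal \<kappa>"
  shows "topspace (G_less_topology \<kappa> X) = topspace X"
proof -
  have "S \<subseteq> topspace X" if "G_less_set \<kappa> X S" for S
    using that by (auto simp: G_less_set_def)
  moreover have "G_less_set \<kappa> X (topspace X)"
    using G_less_set_open[OF assms openin_topspace] .
  ultimately show ?thesis
    unfolding G_less_topology_def topology_generated_by_topspace by blast
qed

lemma openin_G_less_topology:
  assumes "regular_cardinal \<kappa>" and "openin X U"
  shows "openin (G_less_topology \<kappa> X) U"
  using G_less_set_open[OF assms] by (auto simp: G_less_topology_def intro: topology_generated_by_Basis)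

lemma G_less_set_cylinder:
  assumes "regular_cardinal \<kappa>" and "G_less_set \<kappa> (D2_power \<kappa>) S" and "x \<in> S"
  obtains \<gamma> where "\<gamma> < \<kappa>" and "cylinder \<kappa> x \<gamma> \<subseteq> S"
proof -
  obtain \<U> where \<U>: "\<And>U. U \<in> \<U> \<Longrightarrow> openin (D2_power \<kappa>) U" "|\<U>| <o |{..<\<kappa>}|"
    "S = topspace (D2_power \<kappa>) \<inter> \<Inter>\<U>"
    using assms(2) by (auto simp: G_less_set_def)
  have "\<exists>\<gamma><\<kappa>. cylinder \<kappa> x \<gamma> \<subseteq> U" if "U \<in> \<U>" for U
    using D2_power_open_cylinder[OF assms(1) \<U>(1)[OF that]] assms(3) \<U>(3) that by blast
  then obtain g where g: "\<And>U. U \<in> \<U> \<Longrightarrow> g U < \<kappa>" "\<And>U. U \<in> \<U> \<Longrightarrow> cylinder \<kappa> x (g U) \<subseteq> U"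
    by metis
  \<comment> \<open>Fewer than \<kappa> radii, one for each open set of the family, have a common
    bound by regularity.\<close>
  obtain \<gamma> where \<gamma>: "\<gamma> < \<kappa>" "\<And>U. U \<in> \<U> \<Longrightarrow> g U < \<gamma>"
    using regular_cardinal_bound[OF assms(1) \<U>(2), of g] g(1) by blast
  have "cylinder \<kappa> x \<gamma> \<subseteq> U" if "U \<in> \<U>" for U
    using g(2)[OF that] cylinder_antimono[OF less_imp_le[OF \<gamma>(2)[OF that]]] by blast
  moreover have "cylinder \<kappa> x \<gamma> \<subseteq> topspace (D2_power \<kappa>)"
    by (auto simp: cylinder_def)
  ultimately show thesis
    using that \<gamma>(1) \<U>(3) by blast
qed

text \<open>The sets with a cylinder around each of their points contain the generators and are
  closed under binary intersections, by taking the larger radius, and under unions.\<close>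

lemma G_less_topology_open_cylinder:
  assumes "regular_cardinal \<kappa>" and "openin (G_less_topology \<kappa> (D2_power \<kappa>)) U" and "x \<in> U"
  shows "\<exists>\<gamma><\<kappa>. cylinder \<kappa> x \<gamma> \<subseteq> U"
proof -
  have "generate_topology_on {S. G_less_set \<kappa> (D2_power \<kappa>) S} U"
    using assms(2) by (simp add: G_less_topology_def openin_topology_generated_by_iff)
  then show ?thesis
    using assms(3)
  proof (induction arbitrary: x)
    case (Int A B)
    then obtain \<gamma> \<delta> where "\<gamma> < \<kappa>" "\<delta> < \<kappa>" "cylinder \<kappa> x \<gamma> \<subseteq> A" "cylinder \<kappa> x \<delta> \<subseteq> B"
      by (meson IntD1 IntD2)
    then have "max \<gamma> \<delta> < \<kappa>" "cylinder \<kappa> x (max \<gamma> \<delta>) \<subseteq> A \<inter> B"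
      using cylinder_antimono[of \<gamma> "max \<gamma> \<delta>" \<kappa> x] cylinder_antimono[of \<delta> "max \<gamma> \<delta>" \<kappa> x]
      by auto
    then show ?case by blast
  next
    case (UN \<K>)
    then show ?case by (meson Union_iff Union_upper subset_trans)
  next
    case (Basis S)
    then show ?case using G_less_set_cylinder[OF assms(1)] by (metis mem_Collect_eq)
  qed auto
qed

text \<open>What the two topologies share: \<open>finer\<close> supplies the Seeker's moves, and
  \<open>open_cylinder\<close> lets the Hider accept a move.\<close>

locale cylinder_topology =
  fixes \<kappa> :: "'o::wellorder" and X :: "('o \<Rightarrow> bool) topology"
  assumes regular: "regular_cardinal \<kappa>"
    and topspace_eq: "topspace X = topspace (D2_power \<kappa>)"
    and finer: "\<And>U. openin (D2_power \<kappa>) U \<Longrightarrow> openin X U"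
    and open_cylinder: "\<And>U x. openin X U \<Longrightarrow> x \<in> U \<Longrightarrow> \<exists>\<gamma><\<kappa>. cylinder \<kappa> x \<gamma> \<subseteq> U"
begin

section \<open>Upper bound: the Seeker's strategy\<close>

lemma openin_coordinate:
  assumes "\<alpha> < \<kappa>"
  shows "openin X {x \<in> topspace X. x \<alpha>}"
proof -
  have "continuous_map (D2_power \<kappa>) (discrete_topology UNIV) (\<lambda>x. x \<alpha>)"
    unfolding D2_power_def using assms by (intro continuous_map_product_projection) auto
  then have "openin (D2_power \<kappa>) {x \<in> topspace (D2_power \<kappa>). x \<alpha> \<in> {True}}"
    by (rule openin_continuous_map_preimage) auto
  then show ?thesis
    using finer by (simp add: topspace_eq)
qed

text \<open>The goal stays abstract because one strategy serves both games: an outcome with at most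
  one point wins either of them.\<close>

lemma seeker_wins_subsingleton:
  assumes "\<And>W. finite W \<Longrightarrow> card W \<le> 1 \<Longrightarrow> goal W"
  shows "seeker_wins goal X \<kappa>"
  unfolding seeker_wins_def
proof (intro exI conjI allI impI)
  \<comment> \<open>At stage \<alpha> the Seeker asks for coordinate \<alpha>, whatever the history
    \<open>h\<close>.\<close>
  let ?\<sigma> = "\<lambda>\<alpha> (h :: 'o \<Rightarrow> ('o \<Rightarrow> bool) set \<times> ('o \<Rightarrow> bool) set). {x \<in> topspace X. x \<alpha>}"
  show "seeker_strategy X \<kappa> ?\<sigma>"
    using openin_coordinate by (simp add: seeker_strategy_def)
  fix U V assume play: "play_by X \<kappa> ?\<sigma> U V"
  \<comment> \<open>Each answer fixes one coordinate below \<kappa>; all others are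
    \<open>undefined\<close> by extensionality.\<close>
  have "x = y" if "x \<in> outcome X \<kappa> V" "y \<in> outcome X \<kappa> V" for x y
  proof (rule PiE_ext)
    show "x \<in> {..<\<kappa>} \<rightarrow>\<^sub>E UNIV" "y \<in> {..<\<kappa>} \<rightarrow>\<^sub>E UNIV"
      using that by (simp_all add: outcome_def topspace_eq topspace_D2_power)
    fix \<alpha> assume "\<alpha> \<in> {..<\<kappa>}"
    then have "x \<in> V \<alpha>" "y \<in> V \<alpha>" "V \<alpha> = {x \<in> topspace X. x \<alpha>} \<or> V \<alpha> = topspace X - {x \<in> topspace X. x \<alpha>}"
      using that play by (auto simp: outcome_def play_by_def)
    then show "x \<alpha> = y \<alpha>" by blast
  qed
  then have "outcome X \<kappa> V = {} \<or> (\<exists>x. outcome X \<kappa> V = {x})"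
    by blast
  then show "goal (outcome X \<kappa> V)"
    by (intro assms) auto
qed

section \<open>The Hider's play\<close>

text \<open>Any two centres agree wherever both cylinders prescribe values, so the prescribed parts
  glue to one point, and regularity bounds the radii. This covers zero, successor and limit stages
  alike, and also the end of the play.\<close>

lemma coherent_cylinders:
  assumes "\<alpha> < \<kappa>"
    and "\<And>\<xi>. \<xi> < \<alpha> \<Longrightarrow> g \<xi> < \<kappa>"
    and coherent: "\<And>\<xi> \<eta>. \<eta> < \<alpha> \<Longrightarrow> \<xi> < \<eta> \<Longrightarrow> x \<eta> \<in> cylinder \<kappa> (x \<xi>) (g \<xi>)"
  obtains y \<gamma> where "y \<in> topspace X" and "\<gamma> < \<kappa>"
    and "\<And>\<xi>. \<xi> < \<alpha> \<Longrightarrow> g \<xi> \<le> \<gamma>" and "\<And>\<xi>. \<xi> < \<alpha> \<Longrightarrow> y \<in> cylinder \<kappa> (x \<xi>) (g \<xi>)"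
proof -
  \<comment> \<open>Coordinates below \<kappa> that no cylinder prescribes get the default value
    \<open>False\<close>.\<close>
  define y where "y = (\<lambda>i\<in>{..<\<kappa>}. \<exists>\<xi><\<alpha>. i < g \<xi> \<and> x \<xi> i)"
  have y: "y \<in> topspace X"
    by (simp add: y_def topspace_eq topspace_D2_power)
  \<comment> \<open>Of two stages, the later centre lies in the earlier cylinder.\<close>
  have agree: "x \<xi> i = x \<eta> i" if "\<xi> < \<alpha>" "\<eta> < \<alpha>" "i < g \<xi>" "i < g \<eta>" for \<xi> \<eta> i
    using that coherent[of \<xi> \<eta>] coherent[of \<eta> \<xi>]
    by (cases \<xi> \<eta> rule: linorder_cases) (auto simp: cylinder_def)
  have "y i = x \<xi> i" if "\<xi> < \<alpha>" "i < g \<xi>" for \<xi> i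
  proof -
    have "i < \<kappa>"
      using that assms(2) less_trans by blast
    then have "y i \<longleftrightarrow> (\<exists>\<eta><\<alpha>. i < g \<eta> \<and> x \<eta> i)"
      by (simp add: y_def)
    also have "\<dots> \<longleftrightarrow> x \<xi> i"
      using that agree by metis
    finally show ?thesis .
  qed
  then have "y \<in> cylinder \<kappa> (x \<xi>) (g \<xi>)" if "\<xi> < \<alpha>" for \<xi>
    using y that by (simp add: cylinder_def topspace_eq)
  moreover obtain \<gamma> where "\<gamma> < \<kappa>" "\<And>\<xi>. \<xi> \<in> {..<\<alpha>} \<Longrightarrow> g \<xi> < \<gamma>"
    using regular_cardinal_bound[OF regular regular_cardinal_initial[OF regular assms(1)], of g] assms(2)
    by auto
  ultimately show thesis
    using that y by (meson lessThan_iff less_imp_le)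
qed

lemma hider_response:
  assumes "openin X U" and "y \<in> topspace X" and "\<gamma> < \<kappa>"
  obtains V z \<delta> where "V \<in> {U, topspace X - U}" and "z \<in> cylinder \<kappa> y \<gamma>"
    and "\<delta> < \<kappa>" and "cylinder \<kappa> z \<delta> \<subseteq> V"
proof (cases "cylinder \<kappa> y \<gamma> \<inter> U = {}")
  case True
  show thesis
  \<comment> \<open>On rejection the cylinder is kept unchanged, since all of it already avoids
    \<open>U\<close>.\<close>
  proof (rule that[of "topspace X - U" y \<gamma>])
    show "cylinder \<kappa> y \<gamma> \<subseteq> topspace X - U" "y \<in> cylinder \<kappa> y \<gamma>"
      using True assms(2) by (auto simp: cylinder_def topspace_eq)
  qed (use assms(3) in auto)
next
  case False
  then obtain z where z: "z \<in> cylinder \<kappa> y \<gamma>" "z \<in> U"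
    by blast
  then obtain \<delta> where "\<delta> < \<kappa>" "cylinder \<kappa> z \<delta> \<subseteq> U"
    using open_cylinder[OF assms(1)] by blast
  then show thesis
    using that[of U z \<delta>] z(1) by simp
qed

text \<open>The Seeker's moves depend on the Hider's answers, so both are built in one transfinite
  recursion, together with the centre and radius of the current cylinder.\<close>

lemma hider_keeps_cylinder:
  assumes "\<beta> < \<kappa>" and "seeker_strategy X \<beta> \<sigma>"
  obtains U V y \<gamma> where "play_by X \<beta> \<sigma> U V" and "y \<in> topspace X" and "\<gamma> < \<kappa>"
    and "cylinder \<kappa> y \<gamma> \<subseteq> outcome X \<beta> V"
proof -
  \<comment> \<open>Here \<open>u\<close> and \<open>v\<close> are the two moves at stage \<alpha>,
    and the new cylinder has centre \<open>z\<close> and radius \<delta>. The last conjunct keeps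
    the centres coherent.\<close>
  define stage where "stage U V x g \<alpha> u v z \<delta> \<longleftrightarrow>
      u = \<sigma> \<alpha> (restrict (\<lambda>\<xi>. (U \<xi>, V \<xi>)) {..<\<alpha>}) \<and> v \<in> {u, topspace X - u} \<and>
      \<delta> < \<kappa> \<and> cylinder \<kappa> z \<delta> \<subseteq> v \<and> (\<forall>\<xi><\<alpha>. z \<in> cylinder \<kappa> (x \<xi>) (g \<xi>))"
    for U V x g \<alpha> u v z and \<delta> :: 'o
  \<comment> \<open>The data of a stage are packed into one tuple for the recursion. It runs over
    the whole type, so the condition is vacuous from \<beta> on.\<close>
  define P where "P f \<alpha> r \<longleftrightarrow> (\<alpha> < \<beta> \<longrightarrow>
      stage (\<lambda>\<xi>. fst (f \<xi>)) (\<lambda>\<xi>. fst (snd (f \<xi>))) (\<lambda>\<xi>. fst (snd (snd (f \<xi>)))) (\<lambda>\<xi>. snd (snd (snd (f \<xi>))))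
        \<alpha> (fst r) (fst (snd r)) (fst (snd (snd r))) (snd (snd (snd r))))"
    for f :: "'o \<Rightarrow> ('o \<Rightarrow> bool) set \<times> ('o \<Rightarrow> bool) set \<times> ('o \<Rightarrow> bool) \<times> 'o" and \<alpha> r
  have "\<exists>f. \<forall>\<alpha>. P f \<alpha> (f \<alpha>)"
  proof (rule dependent_wellorder_choice)
    fix f g :: "'o \<Rightarrow> ('o \<Rightarrow> bool) set \<times> ('o \<Rightarrow> bool) set \<times> ('o \<Rightarrow> bool) \<times> 'o" and \<alpha> r
    assume eq: "\<And>\<xi>. \<xi> < \<alpha> \<Longrightarrow> f \<xi> = g \<xi>"
    \<comment> \<open>The condition at \<alpha> sees \<open>f\<close> only below \<alpha>: the
      history is restricted and the coherence clause quantifies over earlier stages.\<close>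
    have "restrict (\<lambda>\<xi>. (fst (f \<xi>), fst (snd (f \<xi>)))) {..<\<alpha>} =
          restrict (\<lambda>\<xi>. (fst (g \<xi>), fst (snd (g \<xi>)))) {..<\<alpha>}"
      using eq by (intro restrict_ext) auto
    then show "P f \<alpha> r = P g \<alpha> r"
      unfolding P_def stage_def using eq by simp
  next
    fix \<alpha> f assume IH: "\<And>\<xi>. \<xi> < \<alpha> \<Longrightarrow> P f \<xi> (f \<xi>)"
    show "\<exists>r. P f \<alpha> r"
    proof (cases "\<alpha> < \<beta>")
      case True
      define U where "U \<xi> = fst (f \<xi>)" for \<xi>
      define V where "V \<xi> = fst (snd (f \<xi>))" for \<xi>
      define x where "x \<xi> = fst (snd (snd (f \<xi>)))" for \<xi>
      define g where "g \<xi> = snd (snd (snd (f \<xi>)))" for \<xi>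
      have stage: "stage U V x g \<xi> (U \<xi>) (V \<xi>) (x \<xi>) (g \<xi>)" if "\<xi> < \<alpha>" for \<xi>
        using IH[OF that] less_trans[OF that True]
        unfolding P_def U_def V_def x_def g_def by blast
      have radius: "g \<xi> < \<kappa>" if "\<xi> < \<alpha>" for \<xi>
        using stage[OF that] unfolding stage_def by blast
      have coherent: "x \<eta> \<in> cylinder \<kappa> (x \<xi>) (g \<xi>)" if "\<eta> < \<alpha>" "\<xi> < \<eta>" for \<xi> \<eta>
        using stage[OF that(1)] that(2) unfolding stage_def by blast
      obtain y \<gamma> where y: "y \<in> topspace X" "\<gamma> < \<kappa>"
          "\<And>\<xi>. \<xi> < \<alpha> \<Longrightarrow> g \<xi> \<le> \<gamma>" "\<And>\<xi>. \<xi> < \<alpha> \<Longrightarrow> y \<in> cylinder \<kappa> (x \<xi>) (g \<xi>)"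
        using coherent_cylinders[where g = g and x = x, OF less_trans[OF True assms(1)] radius coherent]
        by blast
      define u where "u = \<sigma> \<alpha> (restrict (\<lambda>\<xi>. (U \<xi>, V \<xi>)) {..<\<alpha>})"
      have "openin X u"
        using assms(2) True by (simp add: u_def seeker_strategy_def)
      then obtain v z \<delta> where r: "v \<in> {u, topspace X - u}" "z \<in> cylinder \<kappa> y \<gamma>"
          "\<delta> < \<kappa>" "cylinder \<kappa> z \<delta> \<subseteq> v"
        by (rule hider_response[OF _ y(1,2)])
      \<comment> \<open>The radius \<gamma> dominates \<open>g \<xi>\<close>, and \<open>y\<close>
        can replace \<open>x \<xi>\<close> as the centre of the earlier cylinder.\<close>
      have "z \<in> cylinder \<kappa> (x \<xi>) (g \<xi>)" if "\<xi> < \<alpha>" for \<xi>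
      proof -
        have "z \<in> cylinder \<kappa> y (g \<xi>)"
          using cylinder_antimono[OF y(3)[OF that]] r(2) by blast
        also have "\<dots> = cylinder \<kappa> (x \<xi>) (g \<xi>)"
          using y(4)[OF that] by (intro cylinder_cong) (simp add: cylinder_def)
        finally show ?thesis .
      qed
      then have "stage U V x g \<alpha> u v z \<delta>"
        unfolding stage_def using r u_def by blast
      then have "P f \<alpha> (u, v, z, \<delta>)"
        unfolding P_def U_def V_def x_def g_def by simp
      then show ?thesis ..
    qed (simp add: P_def)
  qed
  then obtain f where f: "\<And>\<alpha>. P f \<alpha> (f \<alpha>)"
    by blast
  define U where "U \<xi> = fst (f \<xi>)" for \<xi>
  define V where "V \<xi> = fst (snd (f \<xi>))" for \<xi>
  define x where "x \<xi> = fst (snd (snd (f \<xi>)))" for \<xi>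
  define g where "g \<xi> = snd (snd (snd (f \<xi>)))" for \<xi>
  have stage: "stage U V x g \<alpha> (U \<alpha>) (V \<alpha>) (x \<alpha>) (g \<alpha>)" if "\<alpha> < \<beta>" for \<alpha>
    using f[of \<alpha>] that unfolding P_def U_def V_def x_def g_def by blast
  have radius: "g \<xi> < \<kappa>" if "\<xi> < \<beta>" for \<xi>
    using stage[OF that] unfolding stage_def by blast
  have coherent: "x \<eta> \<in> cylinder \<kappa> (x \<xi>) (g \<xi>)" if "\<eta> < \<beta>" "\<xi> < \<eta>" for \<xi> \<eta>
    using stage[OF that(1)] that(2) unfolding stage_def by blast
  \<comment> \<open>The same gluing over all stages of the finished play; here \<beta> < \<kappa>
    enters.\<close>
  obtain y \<gamma> where y: "y \<in> topspace X" "\<gamma> < \<kappa>"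
      "\<And>\<xi>. \<xi> < \<beta> \<Longrightarrow> g \<xi> \<le> \<gamma>" "\<And>\<xi>. \<xi> < \<beta> \<Longrightarrow> y \<in> cylinder \<kappa> (x \<xi>) (g \<xi>)"
    using coherent_cylinders[where g = g and x = x, OF assms(1) radius coherent] by blast
  have "cylinder \<kappa> y \<gamma> \<subseteq> V \<alpha>" if "\<alpha> < \<beta>" for \<alpha>
  proof -
    have "cylinder \<kappa> y (g \<alpha>) = cylinder \<kappa> (x \<alpha>) (g \<alpha>)"
      using y(4)[OF that] by (intro cylinder_cong) (simp add: cylinder_def)
    then show ?thesis
      using stage[OF that] cylinder_antimono[OF y(3)[OF that], of \<kappa> y] unfolding stage_def by blast
  qed
  then have "cylinder \<kappa> y \<gamma> \<subseteq> outcome X \<beta> V"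
    by (auto simp: outcome_def cylinder_def topspace_eq)
  moreover have "play_by X \<beta> \<sigma> U V"
    using stage unfolding play_by_def stage_def by blast
  ultimately show thesis
    using that y(1,2) by blast
qed

section \<open>Lower bounds: points of a cylinder that defeat the Seeker\<close>

text \<open>Coordinates from \<gamma> on are free. The choices \<open>True\<close> and
  \<open>False\<close> for \<open>b\<close> give the two points that refute the Seeker's win in both
  games.\<close>

lemma cylinder_contains_eventually_constant:
  assumes "y \<in> topspace X"
  shows "(\<lambda>i\<in>{..<\<kappa>}. if i < \<gamma> then y i else b) \<in> cylinder \<kappa> y \<gamma>"
  using assms by (auto simp: cylinder_def topspace_eq topspace_D2_power PiE_iff extensional_def)

lemma not_seeker_wins_ps:
  assumes "\<beta> < \<kappa>"
  shows "\<not> seeker_wins_ps X \<beta>"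
proof
  assume "seeker_wins_ps X \<beta>"
  then obtain \<sigma> where \<sigma>: "seeker_strategy X \<beta> \<sigma>"
      "\<And>U V. play_by X \<beta> \<sigma> U V \<Longrightarrow> finite (outcome X \<beta> V) \<and> card (outcome X \<beta> V) \<le> 1"
    unfolding seeker_wins_ps_def seeker_wins_def by blast
  obtain U V y \<gamma> where play: "play_by X \<beta> \<sigma> U V" "y \<in> topspace X" "\<gamma> < \<kappa>"
      "cylinder \<kappa> y \<gamma> \<subseteq> outcome X \<beta> V"
    using hider_keeps_cylinder[OF assms \<sigma>(1)] .
  define c where "c b = (\<lambda>i\<in>{..<\<kappa>}. if i < \<gamma> then y i else b)" for b
  have "c True \<in> outcome X \<beta> V" "c False \<in> outcome X \<beta> V"
    using play(4) cylinder_contains_eventually_constant[OF play(2)] unfolding c_def by blast+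
  then have "c True = c False"
    using \<sigma>(2)[OF play(1)] card_le_Suc0_iff_eq by auto
  \<comment> \<open>The first free coordinate is \<gamma> itself, and it lies below
    \<kappa>.\<close>
  then have "c True \<gamma> = c False \<gamma>"
    by simp
  then show False
    using play(3) by (simp add: c_def)
qed

lemma not_seeker_wins_sm_eventually_true:
  assumes "\<beta> < \<kappa>"
  shows "\<not> seeker_wins_sm {x \<in> topspace X. \<exists>\<gamma><\<kappa>. \<forall>\<xi>. \<gamma> \<le> \<xi> \<longrightarrow> \<xi> < \<kappa> \<longrightarrow> x \<xi>} X \<beta>"
    (is "\<not> seeker_wins_sm ?Y X \<beta>")
proof
  assume "seeker_wins_sm ?Y X \<beta>"
  then obtain \<sigma> where \<sigma>: "seeker_strategy X \<beta> \<sigma>"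
      "\<And>U V. play_by X \<beta> \<sigma> U V \<Longrightarrow> outcome X \<beta> V \<subseteq> ?Y \<or> outcome X \<beta> V \<inter> ?Y = {}"
    unfolding seeker_wins_sm_def seeker_wins_def by blast
  obtain U V y \<gamma> where play: "play_by X \<beta> \<sigma> U V" "y \<in> topspace X" "\<gamma> < \<kappa>"
      "cylinder \<kappa> y \<gamma> \<subseteq> outcome X \<beta> V"
    using hider_keeps_cylinder[OF assms \<sigma>(1)] .
  define c where "c b = (\<lambda>i\<in>{..<\<kappa>}. if i < \<gamma> then y i else b)" for b
  have c: "c b \<in> outcome X \<beta> V" for b
    using play(4) cylinder_contains_eventually_constant[OF play(2)] unfolding c_def by blast+
  have "c True \<in> topspace X"
    using c by (auto simp: outcome_def)
  then have "c True \<in> ?Y"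
    using play(3) by (auto simp: c_def intro!: exI[of _ \<gamma>])
  \<comment> \<open>Whatever threshold \<delta> is proposed, \<open>max \<gamma> \<delta>\<close> is
    a coordinate below \<kappa> beyond it at which \<open>c False\<close> is false.\<close>
  moreover have "\<not> c False (max \<gamma> \<delta>)" if "\<delta> < \<kappa>" for \<delta>
    using that play(3) by (simp add: c_def)
  then have "c False \<notin> ?Y"
    using play(3) by (auto intro: max.cobounded2)
  ultimately show False
    using \<sigma>(2)[OF play(1)] c by blast
qed

section \<open>The values of \<open>ps\<close> and \<open>sm\<close>\<close>

lemma seeker_wins_ps: "seeker_wins_ps X \<kappa>"
  unfolding seeker_wins_ps_def by (intro seeker_wins_subsingleton) auto

lemma seeker_wins_sm: "seeker_wins_sm Y X \<kappa>"
  unfolding seeker_wins_sm_def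
proof (rule seeker_wins_subsingleton)
  fix W :: "('o \<Rightarrow> bool) set" assume "finite W" "card W \<le> 1"
  then have "\<forall>x\<in>W. \<forall>y\<in>W. x = y"
    using card_le_Suc0_iff_eq by auto
  then show "W \<subseteq> Y \<or> W \<inter> Y = {}"
    by (metis disjoint_iff subsetI)
qed

lemma ps_eq: "ps X = \<kappa>"
  unfolding ps_def
proof (rule Least_equality)
  show "\<kappa> \<le> \<beta>" if "seeker_wins_ps X \<beta>" for \<beta>
    using that not_seeker_wins_ps not_less by blast
qed (rule seeker_wins_ps)

lemma sm_at_le: "sm_at Y X \<le> \<kappa>"
  unfolding sm_at_def by (rule Least_le) (rule seeker_wins_sm)

text \<open>The minimum is attained because \<kappa> itself is a winning length.\<close>

lemma seeker_wins_sm_at: "seeker_wins_sm Y X (sm_at Y X :: 'o)"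
  unfolding sm_at_def by (rule LeastI) (rule seeker_wins_sm)

text \<open>The length \<kappa> suffices for every \<open>Y\<close>, and the set of eventually true
  sequences already requires it.\<close>

lemma sm_eq: "sm X = \<kappa>"
  unfolding sm_def
proof (rule Least_equality)
  show "\<forall>Y. Y \<subseteq> topspace X \<longrightarrow> sm_at Y X \<le> \<kappa>"
    using sm_at_le by blast
next
  fix \<beta> :: 'o assume \<beta>: "\<forall>Y. Y \<subseteq> topspace X \<longrightarrow> sm_at Y X \<le> \<beta>"
  let ?Y = "{x \<in> topspace X. \<exists>\<gamma><\<kappa>. \<forall>\<xi>. \<gamma> \<le> \<xi> \<longrightarrow> \<xi> < \<kappa> \<longrightarrow> x \<xi>}"
  have "\<kappa> \<le> sm_at ?Y X"
    using not_seeker_wins_sm_eventually_true seeker_wins_sm_at not_less by blast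
  also have "\<dots> \<le> \<beta>"
    by (rule \<beta>[rule_format]) (rule Collect_restrict)
  finally show "\<kappa> \<le> \<beta>" .
qed

end

theorem theorem4p1:
  fixes \<kappa> :: "'o::wellorder"
  assumes "regular_cardinal \<kappa>"
  shows "sm (D2_power \<kappa>) = \<kappa> \<and>
         ps (D2_power \<kappa>) = \<kappa> \<and>
         ps (G_less_topology \<kappa> (D2_power \<kappa>)) = \<kappa> \<and>
         sm (G_less_topology \<kappa> (D2_power \<kappa>)) = \<kappa>"
proof -
  interpret product: cylinder_topology \<kappa> "D2_power \<kappa>"
  proof
    show "\<exists>\<gamma><\<kappa>. cylinder \<kappa> x \<gamma> \<subseteq> U" if "openin (D2_power \<kappa>) U" "x \<in> U" for U x
      using D2_power_open_cylinder[OF assms that] by blast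
  qed (use assms in auto)
  interpret G_less: cylinder_topology \<kappa> "G_less_topology \<kappa> (D2_power \<kappa>)"
    using assms topspace_G_less_topology[OF assms] openin_G_less_topology[OF assms]
      G_less_topology_open_cylinder[OF assms]
    by unfold_locales
  show ?thesis
    using product.sm_eq product.ps_eq G_less.ps_eq G_less.sm_eq by blast
qed

end
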